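(* Let $E$ be a Dedekind complete vector lattice. Suppose that $(S_\alpha)_{\alpha\in A}$ is a net in $\mathrm{Orth}(E)$ such that $S_\alpha\xrightarrow{\mathrm{SO}}S$ in $\mathcal{L}_{\mathrm{ob}}(E)$ for some $S\in\mathcal{L}_{\mathrm{ob}}(E)$, and that $(T_\beta)_{\beta\in B}$ is a net in $\mathcal{L}_{\mathrm{ob}}(E)$ such that $T_\beta\xrightarrow{\mathrm{SO}}T$ in $\mathcal{L}_{\mathrm{ob}}(E)$ for some $T\in\mathcal{L}_{\mathrm{ob}}(E)$. Then $S\in\mathrm{Orth}(E)$, and $S_\alpha T_\beta\xrightarrow{\mathrm{SO}}ST$ in $\mathcal{L}_{\mathrm{ob}}(E)$.
   Context: All vector lattices are real and Archimedean. $\mathcal{L}_{\mathrm{ob}}(E)$ is the space of order bounded linear operators on $E$; $\mathrm{Orth}(E)$ is the set of orthomorphisms on $E$, i.e. of order bounded linear operators $T:E\to E$ with $T(B)\subseteq B$ for every band $B$ of $E$. In $E$, a net $(x_\alpha)_{\alpha\in A}$ is order convergent to $x$ ($x_\alpha\xrightarrow{\mathrm{o}}x$) if there is a net $(y_\beta)_{\beta\in B}$ in $E$ with $y_\beta\downarrow 0$ such that for every $\beta_0\in B$ there is $\alpha_0\in A$ with $|x-x_\alpha|\le y_{\beta_0}$ for all $\alpha\ge\alpha_0$. Strong order convergence $T_\alpha\xrightarrow{\mathrm{SO}}T$ in $\mathcal{L}_{\mathrm{ob}}(E)$ means $T_\alpha x\xrightarrow{\mathrm{o}}Tx$ in $E$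 for all $x\in E$. The net $(S_\alpha T_\beta)$ is indexed by $A\times B$ with the product order. *)

theory Defs
  imports Complex_Main "HOL-Library.Lattice_Algebras" "HOL-Library.Lub_Glb"
begin

class vector_lattice = ordered_real_vector + lattice_ab_group_add_abs

text \<open>The axioms of \<^class>\<open>conditionally_complete_lattice\<close> constrain \<^const>\<open>Sup\<close> and
  \<^const>\<open>Inf\<close> only on non-empty bounded sets, so this is exactly Dedekind completeness.\<close>

class dedekind_complete_vector_lattice = vector_lattice + conditionally_complete_lattice

text \<open>The Archimedean property need not be assumed separately.\<close>

lemma dedekind_complete_archimedean:
  fixes x y :: "'a::dedekind_complete_vector_lattice"
  assumes "\<And>n::nat. real n *\<^sub>R x \<le> y"
  shows "x \<le> 0"
proof -
  let ?X = "range (\<lambda>n::nat. real n *\<^sub>R x)"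
  have bdd: "bdd_above ?X"
    using assms by (auto intro!: bdd_aboveI[of _ y])
  have "z \<le> Sup ?X - x" if "z \<in> ?X" for z
  proof -
    from that obtain n :: nat where z: "z = real n *\<^sub>R x" by blast
    have "real (Suc n) *\<^sub>R x \<le> Sup ?X"
      by (rule cSup_upper[OF _ bdd]) blast
    then show ?thesis
      unfolding z by (simp add: scaleR_left_distrib le_diff_eq add.commute)
  qed
  then have "Sup ?X \<le> Sup ?X - x"
    by (intro cSup_least) auto
  then show ?thesis by simp
qed

definition order_bounded_set :: "'a::vector_lattice set \<Rightarrow> bool" where
  "order_bounded_set X \<longleftrightarrow> bdd_below X \<and> bdd_above X"

definition L_ob :: "('a::vector_lattice \<Rightarrow> 'b::vector_lattice) set" where
  "L_ob = {T. linear T \<and> (\<forall>X. order_bounded_set X \<longrightarrow> order_bounded_set (T ` X))}"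

definition order_ideal :: "'a::vector_lattice set \<Rightarrow> bool" where
  "order_ideal I \<longleftrightarrow> subspace I \<and> (\<forall>x\<in>I. \<forall>y. \<bar>y\<bar> \<le> \<bar>x\<bar> \<longrightarrow> y \<in> I)"

definition band :: "'a::vector_lattice set \<Rightarrow> bool" where
  "band B \<longleftrightarrow> order_ideal B \<and> (\<forall>X s. X \<subseteq> B \<and> isLub UNIV X s \<longrightarrow> s \<in> B)"

definition Orth :: "('a::vector_lattice \<Rightarrow> 'a) set" where
  "Orth = {T \<in> L_ob. \<forall>B. band B \<longrightarrow> T ` B \<subseteq> B}"

text \<open>A net is given by an index set \<open>A\<close>, a relation \<open>r\<close> directing it, and a family whose values
  outside \<open>A\<close> are irrelevant; \<open>(a, b) \<in> r\<close> means \<open>a \<le> b\<close>. Antisymmetry is not required.\<close>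

definition directed_set :: "'i set \<Rightarrow> 'i rel \<Rightarrow> bool" where
  "directed_set A r \<longleftrightarrow> A \<noteq> {} \<and> preorder_on A r \<and>
     (\<forall>a\<in>A. \<forall>b\<in>A. \<exists>c\<in>A. (a, c) \<in> r \<and> (b, c) \<in> r)"

definition prod_rel :: "'i rel \<Rightarrow> 'j rel \<Rightarrow> ('i \<times> 'j) rel" where
  "prod_rel r s = {((a, b), (a', b')). (a, a') \<in> r \<and> (b, b') \<in> s}"

definition decreases_to_zero :: "'i set \<Rightarrow> 'i rel \<Rightarrow> ('i \<Rightarrow> 'a::vector_lattice) \<Rightarrow> bool" where
  "decreases_to_zero B s y \<longleftrightarrow> directed_set B s \<and>
     (\<forall>a\<in>B. \<forall>b\<in>B. (a, b) \<in> s \<longrightarrow> y b \<le> y a) \<and> isGlb UNIV (y ` B) 0"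

definition order_convergent_via ::
  "'j set \<Rightarrow> 'j rel \<Rightarrow> ('j \<Rightarrow> 'a) \<Rightarrow> 'i set \<Rightarrow> 'i rel \<Rightarrow> ('i \<Rightarrow> 'a::vector_lattice) \<Rightarrow> 'a \<Rightarrow> bool" where
  "order_convergent_via B s y A r x l \<longleftrightarrow> decreases_to_zero B s y \<and>
     (\<forall>b0\<in>B. \<exists>a0\<in>A. \<forall>a\<in>A. (a0, a) \<in> r \<longrightarrow> \<bar>l - x a\<bar> \<le> y b0)"

text \<open>HOL cannot quantify over the type indexing the dominating net \<open>y\<close>, so its index set is taken
  inside the vector lattice itself. By \<open>order_convergentI\<close> below, this loses no generality: a
  decreasing net may be replaced by its range, indexed by itself in the reversed order.\<close>

definition order_convergent ::
  "'i set \<Rightarrow> 'i rel \<Rightarrow> ('i \<Rightarrow> 'a::vector_lattice) \<Rightarrow> 'a \<Rightarrow> bool" where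
  "order_convergent A r x l \<longleftrightarrow>
     (\<exists>(B :: 'a set) (s :: 'a rel) (y :: 'a \<Rightarrow> 'a). order_convergent_via B s y A r x l)"

lemma order_convergentI:
  fixes B :: "'j set" and x :: "'i \<Rightarrow> 'a::vector_lattice"
  assumes "order_convergent_via B s y A r x l"
  shows "order_convergent A r x l"
proof -
  let ?B = "y ` B"
  let ?s = "{(u, v). u \<in> ?B \<and> v \<in> ?B \<and> v \<le> u}"
  from assms have dir: "directed_set B s"
    and mono: "\<And>a b. a \<in> B \<Longrightarrow> b \<in> B \<Longrightarrow> (a, b) \<in> s \<Longrightarrow> y b \<le> y a"
    and glb: "isGlb UNIV (y ` B) 0"
    and dom: "\<And>b0. b0 \<in> B \<Longrightarrow> \<exists>a0\<in>A. \<forall>a\<in>A. (a0, a) \<in> r \<longrightarrow> \<bar>l - x a\<bar> \<le> y b0"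
    unfolding order_convergent_via_def decreases_to_zero_def by auto
  have "preorder_on ?B ?s"
    by (auto simp: preorder_on_def refl_on_def intro!: transI)
  moreover have "\<exists>c\<in>?B. (u, c) \<in> ?s \<and> (v, c) \<in> ?s" if "u \<in> ?B" "v \<in> ?B" for u v
  proof -
    from that obtain a b where ab: "a \<in> B" "u = y a" "b \<in> B" "v = y b" by blast
    with dir obtain c where "c \<in> B" "(a, c) \<in> s" "(b, c) \<in> s"
      unfolding directed_set_def by blast
    with ab mono show ?thesis by (intro bexI[of _ "y c"]) auto
  qed
  ultimately have "directed_set ?B ?s"
    using dir unfolding directed_set_def by blast
  then have "order_convergent_via ?B ?s (\<lambda>u. u) A r x l"
    using glb dom unfolding order_convergent_via_def decreases_to_zero_def by auto
  then show ?thesis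
    unfolding order_convergent_def by blast
qed

definition SO_convergent ::
  "'i set \<Rightarrow> 'i rel \<Rightarrow> ('i \<Rightarrow> 'a::vector_lattice \<Rightarrow> 'b::vector_lattice) \<Rightarrow> ('a \<Rightarrow> 'b) \<Rightarrow> bool" where
  "SO_convergent A r T L \<longleftrightarrow> (\<forall>a\<in>A. T a \<in> L_ob) \<and> L \<in> L_ob \<and>
     (\<forall>x. order_convergent A r (\<lambda>a. T a x) (L x))"

end

theory Submission
  imports Defs
begin

text \<open>
  That \<open>S\<close> is an orthomorphism holds because bands are closed under order limits
  (\<open>band_order_limit\<close>). For the product, split the error as
  \<open>S (T x) - S\<^sub>\<alpha> (T\<^sub>\<beta> x) = S\<^sub>\<alpha> (T x - T\<^sub>\<beta> x) + (S (T x) - S\<^sub>\<alpha> (T x))\<close>. The last bracket tends to zero by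
  hypothesis. In the other summand \<open>z = T x - T\<^sub>\<beta> x\<close> tends to zero, but the operator in front of it
  varies, so a form of order continuity is needed that is uniform in \<open>\<alpha>\<close>.

  Fix \<open>u\<close> with \<open>\<bar>z\<bar> \<le> u\<close> for all large \<open>\<beta>\<close>. Since \<open>S\<^sub>\<alpha> u\<close> converges, \<open>\<bar>S\<^sub>\<alpha> u\<bar> \<le> w\<close> for some \<open>w\<close> and all
  large \<open>\<alpha>\<close>. A single vector controls these operators on all of \<open>[-u, u]\<close>: for an orthomorphism \<open>P\<close>
  with \<open>\<bar>P u\<bar> \<le> p\<close>, and \<open>0 \<le> z \<le> u\<close>,
  \<open>\<bar>P z\<bar> \<le> p / m + n m z + (p - n u)\<^sup>+\<close> for all \<open>m \<ge> 1\<close> and \<open>n\<close> (\<open>Orth_abs_le_uniform\<close>). The right-hand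
  side does not mention \<open>P\<close>. Let \<open>z\<close> decrease to zero, then let \<open>n\<close> and then \<open>m\<close> grow: its infimum
  is zero as soon as \<open>(p - n u)\<^sup>+\<close> decreases to zero, which means that \<open>p\<close> lies in the band generated by
  \<open>u\<close>. Orthomorphisms map \<open>u\<close> into that band, so \<open>w\<close> may be replaced by its component \<open>p\<close> there
  (\<open>Orth_bound_in_principal_band\<close>).

  The displayed inequality rests on two facts. Orthomorphisms preserve disjointness, since disjoint
  complements are bands; and they satisfy \<open>\<bar>P z\<bar> \<le> \<bar>P u\<bar>\<close> for \<open>0 \<le> z \<le> u\<close> (\<open>Orth_abs_mono\<close>). Order
  convergence itself is handled through the set of all eventual error bounds, so that no
  dominating net has to be constructed (\<open>order_convergent_iff_eventual_bounds\<close>).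
\<close>

section \<open>Disjointness in vector lattices\<close>

definition lat_disjoint :: "'a::vector_lattice \<Rightarrow> 'a \<Rightarrow> bool" where
  "lat_disjoint x y \<longleftrightarrow> inf \<bar>x\<bar> \<bar>y\<bar> = 0"

lemma lat_disjoint_commute: "lat_disjoint x y \<longleftrightarrow> lat_disjoint y x"
  by (simp add: lat_disjoint_def inf.commute)

lemma lat_disjoint_minus_right [simp]: "lat_disjoint x (- y) \<longleftrightarrow> lat_disjoint x y"
  by (simp add: lat_disjoint_def)

lemma add_eq_sup_if_inf_eq_0:
  fixes a b :: "'a::vector_lattice"
  assumes "inf a b = 0"
  shows "a + b = sup a b"
  using assms add_eq_inf_sup[of a b] by simp

text \<open>The way disjointness is exploited in estimates: a summand of an upper bound may be dropped
  when it is disjoint from the quantity being bounded.\<close>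

lemma disjoint_summand_cancel:
  fixes a b c :: "'a::vector_lattice"
  assumes "a \<le> b + c" "inf a c = 0" "0 \<le> b"
  shows "a \<le> b"
proof -
  have "a + c = sup a c"
    by (rule add_eq_sup_if_inf_eq_0) fact
  also have "\<dots> \<le> b + c"
    using assms by simp
  finally show ?thesis
    by simp
qed

lemma pprt_diff_eq: "pprt (a - b) = sup a b - (b::'a::vector_lattice)"
  using add_sup_distrib_right[of a b "- b"] by (simp add: pprt_def)

lemma le_add_pprt_diff: "a \<le> b + pprt (a - (b::'a::vector_lattice))"
  by (simp add: pprt_diff_eq)

lemma abs_eq_pprt_add_pprt_minus: "\<bar>a\<bar> = pprt a + pprt (- (a::'a::vector_lattice))"
  by (simp add: abs_prts pprt_neg)

lemma inf_pprt_pprt_minus: "inf (pprt a) (pprt (- a)) = (0::'a::vector_lattice)"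
proof -
  have "\<bar>a\<bar> \<le> sup (pprt a) (pprt (- a))"
    by (intro abs_leI) (simp_all add: pprt_def le_supI1 le_supI2)
  then have "sup (pprt a) (pprt (- a)) + inf (pprt a) (pprt (- a)) \<le> sup (pprt a) (pprt (- a))"
    unfolding abs_eq_pprt_add_pprt_minus add_eq_inf_sup[symmetric] .
  then show ?thesis
    by (intro antisym) auto
qed

lemma lat_disjoint_mono:
  assumes "lat_disjoint x e" "\<bar>y\<bar> \<le> \<bar>x\<bar>"
  shows "lat_disjoint y e"
proof -
  have "inf \<bar>y\<bar> \<bar>e\<bar> \<le> inf \<bar>x\<bar> \<bar>e\<bar>"
    by (rule inf_mono) (use assms in auto)
  moreover have "0 \<le> inf \<bar>y\<bar> \<bar>e\<bar>"
    by simp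
  ultimately show ?thesis
    using assms(1) unfolding lat_disjoint_def by simp
qed

text \<open>The inequality \<open>\<bar>a\<bar> \<le> \<bar>a + b\<bar> + \<bar>b\<bar>\<close> loses its last summand by disjointness; likewise for
  \<open>\<bar>b\<bar>\<close>. So \<open>\<bar>a + b\<bar>\<close> dominates the supremum of \<open>\<bar>a\<bar>\<close> and \<open>\<bar>b\<bar>\<close>, which is their sum.\<close>

lemma lat_disjoint_abs_add:
  fixes a b :: "'a::vector_lattice"
  assumes "lat_disjoint a b"
  shows "\<bar>a + b\<bar> = \<bar>a\<bar> + \<bar>b\<bar>"
proof (rule antisym)
  have "\<bar>a\<bar> \<le> \<bar>a + b\<bar>"
  proof (rule disjoint_summand_cancel)
    show "\<bar>a\<bar> \<le> \<bar>a + b\<bar> + \<bar>b\<bar>"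
      using abs_triangle_ineq4[of "a + b" b] by simp
  qed (use assms in \<open>auto simp: lat_disjoint_def\<close>)
  moreover have "\<bar>b\<bar> \<le> \<bar>a + b\<bar>"
  proof (rule disjoint_summand_cancel)
    show "\<bar>b\<bar> \<le> \<bar>a + b\<bar> + \<bar>a\<bar>"
      using abs_triangle_ineq4[of "a + b" a] by simp
  qed (use assms in \<open>auto simp: lat_disjoint_def inf.commute\<close>)
  ultimately show "\<bar>a\<bar> + \<bar>b\<bar> \<le> \<bar>a + b\<bar>"
    using assms by (simp add: lat_disjoint_def add_eq_sup_if_inf_eq_0)
qed (rule abs_triangle_ineq)

lemma lat_disjoint_add:
  assumes "lat_disjoint x e" "lat_disjoint y e"
  shows "lat_disjoint (x + y) e"
proof -
  let ?t = "inf \<bar>x + y\<bar> \<bar>e\<bar>"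
  have t0: "0 \<le> ?t"
    by simp
  have "inf ?t \<bar>y\<bar> \<le> inf \<bar>y\<bar> \<bar>e\<bar>"
    by (intro inf_greatest) (auto intro: le_infI1)
  then have "inf ?t \<bar>y\<bar> \<le> 0"
    using assms(2) by (simp only: lat_disjoint_def)
  then have ty: "inf ?t \<bar>y\<bar> = 0"
    by (intro antisym) auto
  have "?t \<le> \<bar>x + y\<bar>"
    by simp
  also have "\<dots> \<le> \<bar>x\<bar> + \<bar>y\<bar>"
    by (rule abs_triangle_ineq)
  finally have "?t \<le> \<bar>x\<bar>"
    using ty by (rule disjoint_summand_cancel) simp
  then have "?t \<le> inf \<bar>x\<bar> \<bar>e\<bar>"
    by simp
  then show ?thesis
    using assms(1) t0 unfolding lat_disjoint_def by (intro antisym) auto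
qed

lemma abs_scaleR_le:
  fixes x :: "'a::vector_lattice"
  shows "\<bar>c *\<^sub>R x\<bar> \<le> \<bar>c\<bar> *\<^sub>R \<bar>x\<bar>"
proof (cases "0 \<le> c")
  case True
  have "c *\<^sub>R x \<le> c *\<^sub>R \<bar>x\<bar>" "c *\<^sub>R (- x) \<le> c *\<^sub>R \<bar>x\<bar>"
    by (intro scaleR_left_mono True abs_ge_self abs_ge_minus_self)+
  with True show ?thesis
    by (intro abs_leI) auto
next
  case False
  then have "0 \<le> - c"
    by simp
  then have "(- c) *\<^sub>R x \<le> (- c) *\<^sub>R \<bar>x\<bar>" "(- c) *\<^sub>R (- x) \<le> (- c) *\<^sub>R \<bar>x\<bar>"
    by (intro scaleR_left_mono abs_ge_self abs_ge_minus_self; assumption)+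
  with False show ?thesis
    by (intro abs_leI) auto
qed

lemma lat_disjoint_scaleR:
  assumes "lat_disjoint x e"
  shows "lat_disjoint (c *\<^sub>R x) e"
proof -
  let ?t = "inf \<bar>c *\<^sub>R x\<bar> \<bar>e\<bar>"
  define k where "k = max 1 \<bar>c\<bar>"
  have k: "1 \<le> k" "\<bar>c\<bar> \<le> k"
    by (auto simp: k_def)
  have "?t \<le> \<bar>c\<bar> *\<^sub>R \<bar>x\<bar>"
    by (rule le_infI1) (rule abs_scaleR_le)
  also have "\<dots> \<le> k *\<^sub>R \<bar>x\<bar>"
    by (rule scaleR_right_mono) (use k in auto)
  finally have "inverse k *\<^sub>R ?t \<le> inverse k *\<^sub>R k *\<^sub>R \<bar>x\<bar>"
    by (rule scaleR_left_mono) (use k in auto)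
  then have 1: "inverse k *\<^sub>R ?t \<le> \<bar>x\<bar>"
    using k by simp
  have "inverse k *\<^sub>R ?t \<le> 1 *\<^sub>R ?t"
    by (rule scaleR_right_mono) (use k in \<open>auto simp: field_simps\<close>)
  then have 2: "inverse k *\<^sub>R ?t \<le> \<bar>e\<bar>"
    by (auto intro: order_trans)
  from 1 2 have "inverse k *\<^sub>R ?t \<le> 0"
    using assms unfolding lat_disjoint_def by (metis inf_greatest)
  then have "k *\<^sub>R inverse k *\<^sub>R ?t \<le> k *\<^sub>R 0"
    by (rule scaleR_left_mono) (use k in auto)
  then have "?t \<le> 0"
    using k by simp
  then show ?thesis
    unfolding lat_disjoint_def by (intro antisym) auto
qed

text \<open>The least upper bound \<open>s\<close> is compared with a fixed \<open>x0 \<in> X\<close>. Whatever \<open>s - x0\<close> has in common with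
  \<open>\<bar>e\<bar>\<close>, namely \<open>t\<close>, can be subtracted from \<open>s\<close> without losing the upper bound property, because each
  \<open>(x - x0)\<^sup>+\<close> is disjoint from \<open>e\<close>; hence \<open>t = 0\<close>.\<close>

lemma lat_disjoint_isLub:
  assumes X: "\<And>x. x \<in> X \<Longrightarrow> lat_disjoint x e" and lub: "isLub UNIV X s"
  shows "lat_disjoint s e"
proof (cases "X = {}")
  case True
  \<comment> \<open>a least upper bound of the empty set is a least element, and only the zero space has one\<close>
  have least: "s \<le> z" for z
    using isLub_le_isUb[OF lub, of z] True by (auto intro: isUb_UNIV_I)
  from least[of 0] least[of "s + s"] have "s = 0"
    by (intro antisym) auto
  then show ?thesis
    by (simp add: lat_disjoint_def inf_absorb1)
next
  case False
  then obtain x0 where x0: "x0 \<in> X"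
    by blast
  define t where "t = inf (s - x0) \<bar>e\<bar>"
  have s: "x \<le> s" if "x \<in> X" for x
    using isLubD2[OF lub that] .
  have t0: "0 \<le> t"
    using s[OF x0] by (simp add: t_def)
  have "x \<le> s - t" if x: "x \<in> X" for x
  proof -
    let ?p = "sup (x - x0) 0"
    have "lat_disjoint (x + - x0) e"
      using X[OF x] X[OF x0]
      by (intro lat_disjoint_add) (simp_all add: lat_disjoint_def)
    moreover have "\<bar>?p\<bar> \<le> \<bar>x + - x0\<bar>"
      by (simp add: abs_of_nonneg abs_ge_self)
    ultimately have "lat_disjoint ?p e"
      by (rule lat_disjoint_mono)
    then have "inf ?p \<bar>e\<bar> = 0"
      by (simp add: lat_disjoint_def abs_of_nonneg)
    then have "inf ?p t \<le> 0"
      unfolding t_def by (metis inf.mono inf.cobounded2 order_refl)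
    then have "inf ?p t = 0"
      using t0 by (intro antisym) auto
    then have "?p + t = sup ?p t"
      by (rule add_eq_sup_if_inf_eq_0)
    also have "\<dots> \<le> s - x0"
      using s[OF x] s[OF x0] by (auto simp: t_def intro: diff_right_mono)
    finally have "?p + t \<le> s - x0" .
    moreover have "x - x0 + t \<le> ?p + t"
      by simp
    ultimately have "x - x0 + t \<le> s - x0"
      by (rule order_trans[rotated])
    then show ?thesis
      by (simp add: algebra_simps)
  qed
  then have "s \<le> s - t"
    by (intro isLub_le_isUb[OF lub] isUb_UNIV_I) auto
  then have "t = 0"
    using t0 by (intro antisym) auto
  then have "lat_disjoint (s - x0) e"
    using s[OF x0] by (simp add: lat_disjoint_def t_def abs_of_nonneg)
  from lat_disjoint_add[OF this X[OF x0]] show ?thesis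
    by simp
qed

lemma band_disjoint_complement: "band {x. lat_disjoint x e}"
  unfolding band_def order_ideal_def subspace_def
proof (safe)
  show "lat_disjoint 0 e"
    by (simp add: lat_disjoint_def inf_absorb1)
  show "lat_disjoint (x + y) e" if "lat_disjoint x e" "lat_disjoint y e" for x y
    using that by (rule lat_disjoint_add)
  show "lat_disjoint (c *\<^sub>R x) e" if "lat_disjoint x e" for c x
    using that by (rule lat_disjoint_scaleR)
  show "lat_disjoint y e" if "lat_disjoint x e" "\<bar>y\<bar> \<le> \<bar>x\<bar>" for x y
    using that by (rule lat_disjoint_mono)
  show "lat_disjoint s e" if "X \<subseteq> {x. lat_disjoint x e}" "isLub UNIV X s" for X s
    using that(2) by (rule lat_disjoint_isLub[rotated]) (use that(1) in auto)
qed

section \<open>Orthomorphisms\<close>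

lemma Orth_linear: "P \<in> Orth \<Longrightarrow> linear P"
  by (simp add: Orth_def L_ob_def)

lemma Orth_lat_disjoint:
  assumes "P \<in> Orth" "lat_disjoint x e"
  shows "lat_disjoint (P x) e"
  using assms band_disjoint_complement[of e] unfolding Orth_def by blast

text \<open>The positive and negative parts of \<open>x\<close> are disjoint, hence so are their images, and the
  absolute value of a disjoint sum ignores signs.\<close>

lemma Orth_abs_abs:
  assumes "P \<in> Orth"
  shows "\<bar>P \<bar>x\<bar>\<bar> = \<bar>P x\<bar>"
proof -
  define a b where "a = pprt x" and "b = pprt (- x)"
  have x: "x = a - b"
    using prts[of x] by (simp add: a_def b_def pprt_neg)
  have ax: "\<bar>x\<bar> = a + b"
    unfolding a_def b_def by (rule abs_eq_pprt_add_pprt_minus)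
  have "lat_disjoint a b"
    by (simp add: lat_disjoint_def a_def b_def inf_pprt_pprt_minus)
  then have "lat_disjoint (P a) (P b)"
    using Orth_lat_disjoint[OF assms] lat_disjoint_commute by blast
  moreover from this have "lat_disjoint (P a) (- P b)"
    by simp
  ultimately have "\<bar>P a + P b\<bar> = \<bar>P a + - P b\<bar>"
    by (simp only: lat_disjoint_abs_add abs_minus_cancel)
  then show ?thesis
    using Orth_linear[OF assms] by (simp add: x[symmetric] ax linear_add flip: linear_diff)
qed

text \<open>Dedekind completeness gives \<open>K\<close>, the supremum of \<open>\<bar>P v\<bar>\<close> over \<open>0 \<le> v \<le> u\<close>. Writing
  \<open>2 v = u + (2 v - u)\<close> with \<open>\<bar>2 v - u\<bar> \<le> u\<close>, and removing the sign of \<open>2 v - u\<close> by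
  \<open>Orth_abs_abs\<close>, yields \<open>2 \<bar>P v\<bar> \<le> \<bar>P u\<bar> + K\<close>. Taking the supremum gives \<open>2 K \<le> \<bar>P u\<bar> + K\<close>, that is
  \<open>K \<le> \<bar>P u\<bar>\<close>. This avoids constructing the modulus of \<open>P\<close> or approximating \<open>v\<close> by step elements.\<close>

lemma Orth_abs_mono:
  fixes P :: "'a::dedekind_complete_vector_lattice \<Rightarrow> 'a"
  assumes P: "P \<in> Orth" and z: "0 \<le> z" "z \<le> u"
  shows "\<bar>P z\<bar> \<le> \<bar>P u\<bar>"
proof -
  have lin: "linear P"
    using P by (rule Orth_linear)
  let ?V = "(\<lambda>z. \<bar>P z\<bar>) ` {0..u}"
  define K where "K = Sup ?V"
  have "order_bounded_set (P ` {0..u})"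
  proof -
    have "order_bounded_set {0..u}"
      by (simp add: order_bounded_set_def)
    with P show ?thesis
      by (simp add: Orth_def L_ob_def)
  qed
  then have "bdd_below (P ` {0..u})" "bdd_above (P ` {0..u})"
    by (simp_all only: order_bounded_set_def)
  then obtain l h where lh: "\<And>v. v \<in> {0..u} \<Longrightarrow> l \<le> P v \<and> P v \<le> h"
    by (metis bdd_above.E bdd_below.E imageI)
  have "\<bar>P v\<bar> \<le> sup h (- l)" if "v \<in> {0..u}" for v
    using lh[OF that] by (intro abs_leI) (auto intro: le_supI1 le_supI2)
  then have bdd: "bdd_above ?V"
    by (intro bdd_aboveI[of _ "sup h (- l)"]) blast
  have ne: "?V \<noteq> {}"
    using z by auto
  have K: "\<bar>P v\<bar> \<le> K" if "0 \<le> v" "v \<le> u" for v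
    unfolding K_def using bdd that by (intro cSup_upper) auto
  have "\<bar>P v\<bar> \<le> (1/2) *\<^sub>R (\<bar>P u\<bar> + K)" if v: "0 \<le> v" "v \<le> u" for v
  proof -
    let ?w = "(v + v) - u"
    have "?w \<le> u" "- ?w \<le> u"
      using v add_mono[OF v(2) v(2)] by (simp_all add: algebra_simps)
    then have "\<bar>?w\<bar> \<le> u"
      by (rule abs_leI)
    then have "\<bar>P ?w\<bar> \<le> K"
      using K[of "\<bar>?w\<bar>"] Orth_abs_abs[OF P, of ?w] by simp
    moreover have "P v + P v = P u + P ?w"
      using lin by (simp add: linear_diff linear_add)
    ultimately have "\<bar>P v + P v\<bar> \<le> \<bar>P u\<bar> + K"
      by (metis abs_triangle_ineq add_left_mono order_trans)
    then have "(1/2) *\<^sub>R \<bar>P v + P v\<bar> \<le> (1/2) *\<^sub>R (\<bar>P u\<bar> + K)"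
      by (rule scaleR_left_mono) simp
    moreover have "\<bar>P v\<bar> \<le> (1/2) *\<^sub>R \<bar>P v + P v\<bar>"
      using abs_scaleR_le[of "1/2" "P v + P v"] by (simp add: scaleR_half_double)
    ultimately show ?thesis
      by (rule order_trans[rotated])
  qed
  then have "K \<le> (1/2) *\<^sub>R (\<bar>P u\<bar> + K)"
    unfolding K_def by (intro cSup_least ne) auto
  then have "2 *\<^sub>R K \<le> 2 *\<^sub>R (1/2) *\<^sub>R (\<bar>P u\<bar> + K)"
    by (rule scaleR_left_mono) simp
  then have "K \<le> \<bar>P u\<bar>"
    by (simp add: scaleR_2)
  with K[OF z] show ?thesis
    by (rule order_trans)
qed

text \<open>With \<open>k = m + 1\<close>, cut \<open>z\<close> at height \<open>u / k\<close>. The lower part is at most \<open>u / k\<close>, so its image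
  is at most \<open>p / k\<close>. The upper part \<open>x\<close> satisfies \<open>\<bar>P x\<bar> \<le> \<bar>P u\<bar> \<le> p \<le> n u + (p - n u)\<^sup>+\<close>, and it lives
  where \<open>z \<ge> u / k\<close>, that is where \<open>u \<le> k z\<close>; there \<open>n u\<close> may be replaced by \<open>n k z\<close>. As there need not
  be an actual region, this is expressed by adding the error term \<open>n k (u / k - z)\<^sup>+\<close> and dropping it
  again because it is disjoint from \<open>P x\<close>. The bound depends on \<open>P\<close> only through \<open>p\<close>.\<close>

lemma Orth_abs_le_uniform:
  fixes P :: "'a::dedekind_complete_vector_lattice \<Rightarrow> 'a"
  assumes P: "P \<in> Orth" and z: "0 \<le> z" "z \<le> u" and p: "\<bar>P u\<bar> \<le> p"
  shows "\<bar>P z\<bar> \<le> inverse (real (Suc m)) *\<^sub>R p + real (n * Suc m) *\<^sub>R z + pprt (p - real n *\<^sub>R u)"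
proof -
  have lin: "linear P"
    using P by (rule Orth_linear)
  define k where "k = real (Suc m)"
  have k: "0 < k" "1 \<le> k"
    by (auto simp: k_def)
  have u: "0 \<le> u"
    using z by (rule order_trans)
  define eu where "eu = inverse k *\<^sub>R u"
  have "eu \<le> 1 *\<^sub>R u" "0 \<le> eu"
    unfolding eu_def using k u
    by (intro scaleR_right_mono scaleR_nonneg_nonneg; simp add: field_simps)+
  then have eu: "0 \<le> eu" "eu \<le> u"
    by auto
  define x where "x = pprt (z - eu)"
  have zsplit: "z = inf z eu + x"
    unfolding x_def pprt_diff_eq using add_eq_inf_sup[of z eu] by (simp add: algebra_simps)
  have "\<bar>P (inf z eu)\<bar> \<le> \<bar>P eu\<bar>"
    using z eu by (intro Orth_abs_mono[OF P]) auto
  also have "\<dots> = \<bar>inverse k *\<^sub>R P u\<bar>"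
    using lin by (simp add: eu_def linear_scale)
  also have "\<dots> \<le> inverse k *\<^sub>R \<bar>P u\<bar>"
    using abs_scaleR_le[of "inverse k" "P u"] k by simp
  also have "\<dots> \<le> inverse k *\<^sub>R p"
    using p k by (intro scaleR_left_mono) auto
  finally have small: "\<bar>P (inf z eu)\<bar> \<le> inverse k *\<^sub>R p" .
  have x: "0 \<le> x" "x \<le> u"
  proof -
    have "z - eu \<le> z"
      using eu by simp
    then show "x \<le> u"
      unfolding x_def pprt_def using z u by (intro sup_least) (blast intro: order_trans)+
  qed (simp add: x_def)
  have "\<bar>P x\<bar> \<le> (real (n * Suc m) *\<^sub>R z + pprt (p - real n *\<^sub>R u)) + real n *\<^sub>R k *\<^sub>R pprt (eu - z)"
  proof -
    have 1: "\<bar>P x\<bar> \<le> p"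
      using Orth_abs_mono[OF P x] p by (rule order_trans)
    have 2: "p \<le> real n *\<^sub>R u + pprt (p - real n *\<^sub>R u)"
      by (rule le_add_pprt_diff)
    have nk: "real (n * Suc m) = real n * k"
      by (simp only: k_def of_nat_mult)
    have neu: "(real n * k) *\<^sub>R eu = real n *\<^sub>R u"
      using k by (simp add: eu_def)
    have "eu \<le> z + pprt (eu - z)"
      by (rule le_add_pprt_diff)
    then have "(real n * k) *\<^sub>R eu \<le> (real n * k) *\<^sub>R (z + pprt (eu - z))"
      using k by (intro scaleR_left_mono) auto
    then have "real n *\<^sub>R u \<le> real (n * Suc m) *\<^sub>R z + real n *\<^sub>R k *\<^sub>R pprt (eu - z)"
      unfolding nk neu by (simp only: scaleR_add_right scaleR_scaleR)
    then have "p \<le> (real (n * Suc m) *\<^sub>R z + real n *\<^sub>R k *\<^sub>R pprt (eu - z)) + pprt (p - real n *\<^sub>R u)"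
      using 2 by (meson add_right_mono order_trans)
    with 1 show ?thesis
      by (simp add: algebra_simps)
  qed
  moreover have "inf \<bar>P x\<bar> (real n *\<^sub>R k *\<^sub>R pprt (eu - z)) = 0"
  proof -
    have "inf (pprt (z - eu)) (pprt (eu - z)) = 0"
      using inf_pprt_pprt_minus[of "z - eu"] by simp
    then have "lat_disjoint x (pprt (eu - z))"
      by (simp add: lat_disjoint_def x_def)
    then have "lat_disjoint (P x) (pprt (eu - z))"
      by (rule Orth_lat_disjoint[OF P])
    then have "lat_disjoint (P x) (real n *\<^sub>R k *\<^sub>R pprt (eu - z))"
      using lat_disjoint_scaleR lat_disjoint_commute by blast
    moreover have "0 \<le> real n *\<^sub>R k *\<^sub>R pprt (eu - z)"
      using k by (intro scaleR_nonneg_nonneg) auto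
    ultimately show ?thesis
      by (simp add: lat_disjoint_def)
  qed
  ultimately have large: "\<bar>P x\<bar> \<le> real (n * Suc m) *\<^sub>R z + pprt (p - real n *\<^sub>R u)"
    by (rule disjoint_summand_cancel) (use z in \<open>auto intro!: add_nonneg_nonneg scaleR_nonneg_nonneg\<close>)
  have "\<bar>P z\<bar> = \<bar>P (inf z eu) + P x\<bar>"
    using lin zsplit by (metis linear_add)
  also have "\<dots> \<le> \<bar>P (inf z eu)\<bar> + \<bar>P x\<bar>"
    by (rule abs_triangle_ineq)
  also have "\<dots> \<le> inverse k *\<^sub>R p + (real (n * Suc m) *\<^sub>R z + pprt (p - real n *\<^sub>R u))"
    by (intro add_mono small large)
  finally show ?thesis
    by (simp only: k_def add.assoc)
qed

text \<open>The vector \<open>p\<close>, the supremum of all \<open>w \<and> n u\<close>, is the component of \<open>w\<close> in the band generated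
  by \<open>u\<close>. The remainder \<open>w - p\<close> is disjoint from \<open>u\<close>, hence from \<open>P u\<close>, and so can be dropped from the
  bound \<open>\<bar>P u\<bar> \<le> p + (w - p)\<close>. The second property says that the decreasing sequence
  \<open>(p - n u)\<^sup>+\<close> has infimum zero: it is dominated by \<open>p - (w \<and> n u)\<close>.\<close>

lemma Orth_bound_in_principal_band:
  fixes u w :: "'a::dedekind_complete_vector_lattice"
  assumes u: "0 \<le> u"
  obtains p where "\<And>P. P \<in> Orth \<Longrightarrow> \<bar>P u\<bar> \<le> w \<Longrightarrow> \<bar>P u\<bar> \<le> p"
    and "\<And>h. (\<And>n. h \<le> pprt (p - real n *\<^sub>R u)) \<Longrightarrow> h \<le> 0"
proof -
  let ?V = "range (\<lambda>n. inf w (real n *\<^sub>R u))"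
  define p where "p = Sup ?V"
  have bdd: "bdd_above ?V"
    by (auto intro!: bdd_aboveI[of _ w])
  have up: "inf w (real n *\<^sub>R u) \<le> p" for n
    unfolding p_def using bdd by (intro cSup_upper) auto
  have least: "p \<le> b" if "\<And>n. inf w (real n *\<^sub>R u) \<le> b" for b
    unfolding p_def using that by (intro cSup_least) auto
  have pw: "p \<le> w"
    by (rule least) simp
  let ?d = "w - p"
  \<comment> \<open>adding \<open>inf ?d u\<close> to one member of the sequence stays below the next member\<close>
  have "inf w (real n *\<^sub>R u) \<le> p - inf ?d u" for n
  proof -
    have "inf w (real n *\<^sub>R u) + inf ?d u \<le> p + ?d"
      by (intro add_mono up) simp
    moreover have "inf w (real n *\<^sub>R u) + inf ?d u \<le> real n *\<^sub>R u + u"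
      by (intro add_mono) auto
    ultimately have "inf w (real n *\<^sub>R u) + inf ?d u \<le> inf w (real (Suc n) *\<^sub>R u)"
      by (simp add: algebra_simps)
    then have "inf w (real n *\<^sub>R u) + inf ?d u \<le> p"
      using up by (rule order_trans)
    then show ?thesis
      by (simp only: le_diff_eq)
  qed
  then have "p \<le> p - inf ?d u"
    by (rule least)
  then have "inf ?d u \<le> 0"
    by (simp only: le_diff_eq add_le_same_cancel1)
  then have "inf ?d u = 0"
    using pw u by (intro antisym) auto
  then have disj: "lat_disjoint u ?d"
    using pw u by (simp add: lat_disjoint_def inf.commute)
  show thesis
  proof
    fix P :: "'a \<Rightarrow> 'a" assume P: "P \<in> Orth" and le: "\<bar>P u\<bar> \<le> w"
    have "0 \<le> w"
      using abs_ge_zero le by (rule order_trans)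
    then have "0 \<le> p"
      using up[of 0] by (simp add: inf_absorb2)
    moreover have "inf \<bar>P u\<bar> ?d = 0"
      using Orth_lat_disjoint[OF P disj] pw by (simp add: lat_disjoint_def)
    ultimately show "\<bar>P u\<bar> \<le> p"
      using le by (intro disjoint_summand_cancel[of "\<bar>P u\<bar>" p ?d]) auto
  next
    fix h assume h: "\<And>n. h \<le> pprt (p - real n *\<^sub>R u)"
    have "inf w (real n *\<^sub>R u) \<le> p - h" for n
    proof -
      have "pprt (p - real n *\<^sub>R u) \<le> p - inf w (real n *\<^sub>R u)"
        unfolding pprt_def
        by (intro sup_least diff_left_mono) (simp_all only: inf_le2 diff_ge_0_iff_ge up)
      then have "h \<le> p - inf w (real n *\<^sub>R u)"
        using h order_trans by blast
      then show ?thesis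
        by (simp only: le_diff_eq add.commute)
    qed
    then have "p \<le> p - h"
      by (rule least)
    then show "h \<le> 0"
      by simp
  qed
qed

section \<open>Order convergence through eventual error bounds\<close>

definition eventual_bounds ::
  "'i set \<Rightarrow> 'i rel \<Rightarrow> ('i \<Rightarrow> 'a::vector_lattice) \<Rightarrow> 'a \<Rightarrow> 'a set" where
  "eventual_bounds A r x l = {g. \<exists>a0\<in>A. \<forall>a\<in>A. (a0, a) \<in> r \<longrightarrow> \<bar>l - x a\<bar> \<le> g}"

lemma directed_set_refl: "directed_set A r \<Longrightarrow> a \<in> A \<Longrightarrow> (a, a) \<in> r"
  by (auto simp: directed_set_def preorder_on_def refl_on_def)

lemma directed_set_trans: "directed_set A r \<Longrightarrow> (a, b) \<in> r \<Longrightarrow> (b, c) \<in> r \<Longrightarrow> (a, c) \<in> r"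
  by (auto simp: directed_set_def preorder_on_def dest: transD)

lemma eventual_bounds_nonneg:
  assumes "directed_set A r" "g \<in> eventual_bounds A r x l"
  shows "0 \<le> g"
proof -
  from assms(2) obtain a where "a \<in> A" "\<And>b. b \<in> A \<Longrightarrow> (a, b) \<in> r \<Longrightarrow> \<bar>l - x b\<bar> \<le> g"
    unfolding eventual_bounds_def by blast
  with directed_set_refl[OF assms(1)] have "\<bar>l - x a\<bar> \<le> g"
    by blast
  with abs_ge_zero show ?thesis
    by (rule order_trans)
qed

lemma eventual_bounds_common:
  assumes dir: "directed_set A r"
    and "g \<in> eventual_bounds A r x l" "h \<in> eventual_bounds A r x l"
  obtains a where "a \<in> A" "\<And>b. b \<in> A \<Longrightarrow> (a, b) \<in> r \<Longrightarrow> \<bar>l - x b\<bar> \<le> g \<and> \<bar>l - x b\<bar> \<le> h"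
proof -
  from assms(2,3) obtain a1 a2 where a1: "a1 \<in> A" "\<And>b. b \<in> A \<Longrightarrow> (a1, b) \<in> r \<Longrightarrow> \<bar>l - x b\<bar> \<le> g"
    and a2: "a2 \<in> A" "\<And>b. b \<in> A \<Longrightarrow> (a2, b) \<in> r \<Longrightarrow> \<bar>l - x b\<bar> \<le> h"
    unfolding eventual_bounds_def by blast
  from dir a1(1) a2(1) obtain a where a: "a \<in> A" "(a1, a) \<in> r" "(a2, a) \<in> r"
    unfolding directed_set_def by blast
  show thesis
  proof
    show "\<bar>l - x b\<bar> \<le> g \<and> \<bar>l - x b\<bar> \<le> h" if "b \<in> A" "(a, b) \<in> r" for b
      using that a1(2) a2(2) a directed_set_trans[OF dir] by blast
  qed (rule a(1))
qed

text \<open>When the index set is directed, the eventual bounds of a net are closed under binary infima, so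
  they form a decreasing net themselves. This is the largest possible dominating net. Nonemptiness
  says that the net is eventually order bounded, and the second condition that the eventual bounds
  have infimum zero.\<close>

lemma order_convergent_iff_eventual_bounds:
  fixes x :: "'i \<Rightarrow> 'a::vector_lattice"
  assumes dir: "directed_set A r"
  shows "order_convergent A r x l \<longleftrightarrow>
    eventual_bounds A r x l \<noteq> {} \<and>
    (\<forall>h. (\<forall>g\<in>eventual_bounds A r x l. h \<le> g) \<longrightarrow> h \<le> 0)"
    (is "_ \<longleftrightarrow> ?G \<noteq> {} \<and> _")
proof
  assume "order_convergent A r x l"
  then obtain B :: "'a set" and s y where conv: "order_convergent_via B s y A r x l"
    unfolding order_convergent_def by blast
  then have sub: "y ` B \<subseteq> ?G" and ne: "B \<noteq> {}" and glb: "isGlb UNIV (y ` B) 0"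
    unfolding order_convergent_via_def eventual_bounds_def decreases_to_zero_def directed_set_def
    by auto
  have "h \<le> 0" if "\<forall>g\<in>?G. h \<le> g" for h
    using sub that by (intro isGlb_le_isLb[OF glb] isLbI setgeI) auto
  with sub ne show "?G \<noteq> {} \<and> (\<forall>h. (\<forall>g\<in>?G. h \<le> g) \<longrightarrow> h \<le> 0)"
    by blast
next
  assume R: "?G \<noteq> {} \<and> (\<forall>h. (\<forall>g\<in>?G. h \<le> g) \<longrightarrow> h \<le> 0)"
  let ?s = "{(g, h). g \<in> ?G \<and> h \<in> ?G \<and> h \<le> g}"
  have "preorder_on ?G ?s"
    by (auto simp: preorder_on_def refl_on_def intro!: transI)
  moreover have "\<exists>c\<in>?G. (g, c) \<in> ?s \<and> (h, c) \<in> ?s" if gh: "g \<in> ?G" "h \<in> ?G" for g h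
  proof -
    obtain a where "a \<in> A" "\<And>b. b \<in> A \<Longrightarrow> (a, b) \<in> r \<Longrightarrow> \<bar>l - x b\<bar> \<le> g \<and> \<bar>l - x b\<bar> \<le> h"
      using eventual_bounds_common[OF dir gh] by blast
    then have "inf g h \<in> ?G"
      unfolding eventual_bounds_def by (intro CollectI bexI[of _ a]) auto
    with gh show ?thesis
      by (intro bexI[of _ "inf g h"]) auto
  qed
  ultimately have "directed_set ?G ?s"
    using R unfolding directed_set_def by blast
  moreover have "isGlb UNIV ((\<lambda>g. g) ` ?G) 0"
    using R eventual_bounds_nonneg[OF dir]
    by (intro isGlbI2 isLbI setgeI setleI) (auto simp: isLb_def setge_def)
  ultimately have "order_convergent_via ?G ?s (\<lambda>g. g) A r x l"
    unfolding order_convergent_via_def decreases_to_zero_def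
    by (auto simp: eventual_bounds_def)
  then show "order_convergent A r x l"
    by (rule order_convergentI)
qed

text \<open>For an eventual bound \<open>g\<close> and a late member \<open>x a\<close>, \<open>(\<bar>l\<bar> - g)\<^sup>+ \<le> \<bar>x a\<bar>\<close>, so this vector lies in
  the band. Since the eventual bounds have infimum zero, \<open>\<bar>l\<bar>\<close> is the supremum of these vectors.\<close>

lemma band_order_limit:
  assumes dir: "directed_set A r" and lim: "order_convergent A r x l"
    and B: "band B" and x: "\<And>a. a \<in> A \<Longrightarrow> x a \<in> B"
  shows "l \<in> B"
proof -
  let ?G = "eventual_bounds A r x l"
  from lim have glb: "\<And>h. (\<And>g. g \<in> ?G \<Longrightarrow> h \<le> g) \<Longrightarrow> h \<le> 0"
    using order_convergent_iff_eventual_bounds[OF dir] by blast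
  have solid: "y \<in> B" if "v \<in> B" "\<bar>y\<bar> \<le> \<bar>v\<bar>" for v y
    using B that unfolding band_def order_ideal_def by blast
  have "pprt (\<bar>l\<bar> - g) \<in> B" if g: "g \<in> ?G" for g
  proof -
    from eventual_bounds_common[OF dir g g] directed_set_refl[OF dir]
    obtain a where a: "a \<in> A" "\<bar>l - x a\<bar> \<le> g"
      by metis
    have "\<bar>l\<bar> - \<bar>x a\<bar> \<le> g"
      using abs_triangle_ineq2 a(2) by (rule order_trans)
    then have "\<bar>l\<bar> - g \<le> \<bar>x a\<bar>"
      by (simp only: diff_le_eq add.commute)
    then have "pprt (\<bar>l\<bar> - g) \<le> \<bar>x a\<bar>"
      by (simp add: pprt_def)
    then show ?thesis
      using x[OF a(1)] by (intro solid[OF x[OF a(1)]]) (simp add: abs_of_nonneg)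
  qed
  moreover have "isLub UNIV ((\<lambda>g. pprt (\<bar>l\<bar> - g)) ` ?G) \<bar>l\<bar>"
  proof (intro isLubI2 isUb_UNIV_I setgeI ballI)
    fix y assume "y \<in> (\<lambda>g. pprt (\<bar>l\<bar> - g)) ` ?G"
    then show "y \<le> \<bar>l\<bar>"
      using eventual_bounds_nonneg[OF dir] by (auto simp: pprt_def)
  next
    fix b assume "b \<in> Collect (isUb UNIV ((\<lambda>g. pprt (\<bar>l\<bar> - g)) ` ?G))"
    then have b: "pprt (\<bar>l\<bar> - g) \<le> b" if "g \<in> ?G" for g
      using that by (auto simp: isUb_def setle_def)
    have "\<bar>l\<bar> - b \<le> 0"
    proof (rule glb)
      fix g assume "g \<in> ?G"
      then have "\<bar>l\<bar> - g \<le> b"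
        using b[of g] by (auto simp: pprt_def)
      then show "\<bar>l\<bar> - b \<le> g"
        by (simp add: algebra_simps)
    qed
    then show "\<bar>l\<bar> \<le> b"
      by simp
  qed
  ultimately have "\<bar>l\<bar> \<in> B"
    using B unfolding band_def by (metis image_subsetI)
  then show ?thesis
    by (rule solid) simp
qed

section \<open>Products of convergent nets of operators\<close>

lemma directed_set_prod_rel:
  assumes "directed_set A r" "directed_set B s"
  shows "directed_set (A \<times> B) (prod_rel r s)"
  unfolding directed_set_def
proof (intro conjI ballI)
  show "A \<times> B \<noteq> {}"
    using assms by (auto simp: directed_set_def)
  show "preorder_on (A \<times> B) (prod_rel r s)"
    using assms unfolding directed_set_def preorder_on_def refl_on_def trans_def prod_rel_def
    by blast
  fix c d assume "c \<in> A \<times> B" "d \<in> A \<times> B"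
  then show "\<exists>e\<in>A \<times> B. (c, e) \<in> prod_rel r s \<and> (d, e) \<in> prod_rel r s"
    using assms unfolding directed_set_def prod_rel_def by (clarsimp; metis)
qed

text \<open>Passing to the limit in an inequality: a multiple of an arbitrary eventual bound can be
  dropped. For \<open>c = 0\<close> this needs that some eventual bound exists.\<close>

lemma le_if_le_add_scaled_eventual_bounds:
  fixes x :: "'i \<Rightarrow> 'a::vector_lattice"
  assumes dir: "directed_set A r" and lim: "order_convergent A r x l"
    and h: "\<And>g. g \<in> eventual_bounds A r x l \<Longrightarrow> h \<le> q + c *\<^sub>R g" and c: "0 \<le> c"
  shows "h \<le> q"
proof (cases "c = 0")
  case True
  then show ?thesis
    using lim h order_convergent_iff_eventual_bounds[OF dir] by force
next
  case False
  have "inverse c *\<^sub>R (h - q) \<le> g" if g: "g \<in> eventual_bounds A r x l" for g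
  proof -
    have "h - q \<le> c *\<^sub>R g"
      using h[OF g] by (simp add: algebra_simps)
    then have "inverse c *\<^sub>R (h - q) \<le> inverse c *\<^sub>R c *\<^sub>R g"
      by (rule scaleR_left_mono) (use c in auto)
    then show ?thesis
      using False by simp
  qed
  then have "inverse c *\<^sub>R (h - q) \<le> 0"
    using lim order_convergent_iff_eventual_bounds[OF dir] by blast
  then have "c *\<^sub>R inverse c *\<^sub>R (h - q) \<le> c *\<^sub>R 0"
    by (rule scaleR_left_mono) fact
  then show ?thesis
    using False by simp
qed

lemma L_ob_comp: "P \<in> L_ob \<Longrightarrow> Q \<in> L_ob \<Longrightarrow> P \<circ> Q \<in> L_ob"
  by (auto simp: L_ob_def linear_compose image_comp [symmetric] simp del: o_apply)

theorem proposition5p5: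
  fixes Snet :: "'i \<Rightarrow> 'a::dedekind_complete_vector_lattice \<Rightarrow> 'a"
    and Tnet :: "'j \<Rightarrow> 'a \<Rightarrow> 'a"
    and S T :: "'a \<Rightarrow> 'a"
    and A :: "'i set" and r :: "'i rel"
    and B :: "'j set" and s :: "'j rel"
  assumes "directed_set A r"
    and "directed_set B s"
    and "\<And>\<alpha>. \<alpha> \<in> A \<Longrightarrow> Snet \<alpha> \<in> Orth"
    and "S \<in> L_ob"
    and "SO_convergent A r Snet S"
    and "\<And>\<beta>. \<beta> \<in> B \<Longrightarrow> Tnet \<beta> \<in> L_ob"
    and "T \<in> L_ob"
    and "SO_convergent B s Tnet T"
  shows "S \<in> Orth \<and>
    SO_convergent (A \<times> B) (prod_rel r s) (\<lambda>(\<alpha>, \<beta>). Snet \<alpha> \<circ> Tnet \<beta>) (S \<circ> T)"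
proof
  note dirA = assms(1) and dirB = assms(2) and Orth = assms(3)
  have convS: "order_convergent A r (\<lambda>\<alpha>. Snet \<alpha> x) (S x)" for x
    using assms(5) by (simp add: SO_convergent_def)
  have convT: "order_convergent B s (\<lambda>\<beta>. Tnet \<beta> x) (T x)" for x
    using assms(8) by (simp add: SO_convergent_def)
  have "S x \<in> C" if C: "band C" and x: "x \<in> C" for C x
    using Orth C x by (intro band_order_limit[OF dirA convS C]) (auto simp: Orth_def)
  then show "S \<in> Orth"
    using assms(4) by (auto simp: Orth_def)
  have conv: "order_convergent (A \<times> B) (prod_rel r s) (\<lambda>(\<alpha>, \<beta>). Snet \<alpha> (Tnet \<beta> x)) (S (T x))"
    for x
  proof -
    let ?GS = "eventual_bounds A r (\<lambda>\<alpha>. Snet \<alpha> (T x)) (S (T x))"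
    let ?GT = "eventual_bounds B s (\<lambda>\<beta>. Tnet \<beta> x) (T x)"
    let ?G = "eventual_bounds (A \<times> B) (prod_rel r s) (\<lambda>(\<alpha>, \<beta>). Snet \<alpha> (Tnet \<beta> x)) (S (T x))"
    obtain u where u: "u \<in> ?GT"
      using convT order_convergent_iff_eventual_bounds[OF dirB] by blast
    have u0: "0 \<le> u"
      using dirB u by (rule eventual_bounds_nonneg)
    obtain v0 where v0: "v0 \<in> ?GS"
      using convS order_convergent_iff_eventual_bounds[OF dirA] by blast
    obtain w where "w \<in> eventual_bounds A r (\<lambda>\<alpha>. Snet \<alpha> u) (S u)"
      using convS order_convergent_iff_eventual_bounds[OF dirA] by blast
    then obtain a1 where a1: "a1 \<in> A"
      and w: "\<And>\<alpha>. \<alpha> \<in> A \<Longrightarrow> (a1, \<alpha>) \<in> r \<Longrightarrow> \<bar>S u - Snet \<alpha> u\<bar> \<le> w"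
      unfolding eventual_bounds_def by blast
    obtain p where pS: "\<And>P. P \<in> Orth \<Longrightarrow> \<bar>P u\<bar> \<le> \<bar>S u\<bar> + w \<Longrightarrow> \<bar>P u\<bar> \<le> p"
      and p_inf: "\<And>h. (\<And>n. h \<le> pprt (p - real n *\<^sub>R u)) \<Longrightarrow> h \<le> 0"
      using Orth_bound_in_principal_band[OF u0] by blast
    have p: "\<bar>Snet \<alpha> u\<bar> \<le> p" if "\<alpha> \<in> A" "(a1, \<alpha>) \<in> r" for \<alpha>
    proof (rule pS[OF Orth[OF that(1)]])
      have "\<bar>Snet \<alpha> u\<bar> \<le> \<bar>S u\<bar> + \<bar>S u - Snet \<alpha> u\<bar>"
        using abs_triangle_ineq4[of "S u" "S u - Snet \<alpha> u"] by simp
      also have "\<dots> \<le> \<bar>S u\<bar> + w"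
        using w[OF that] by simp
      finally show "\<bar>Snet \<alpha> u\<bar> \<le> \<bar>S u\<bar> + w" .
    qed
    \<comment> \<open>the uniform estimate, with \<open>z\<close> replaced by an eventual bound of \<open>T x - T\<^sub>\<beta> x\<close>\<close>
    have bound: "inverse (real (Suc m)) *\<^sub>R p + real (n * Suc m) *\<^sub>R g + pprt (p - real n *\<^sub>R u) + v \<in> ?G"
      if g: "g \<in> ?GT" and v: "v \<in> ?GS" for g v m n
    proof -
      from v obtain a2 where a2: "a2 \<in> A"
        and va: "\<And>\<alpha>. \<alpha> \<in> A \<Longrightarrow> (a2, \<alpha>) \<in> r \<Longrightarrow> \<bar>S (T x) - Snet \<alpha> (T x)\<bar> \<le> v"
        unfolding eventual_bounds_def by blast
      obtain a where a: "a \<in> A" "(a1, a) \<in> r" "(a2, a) \<in> r"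
        using dirA a1 a2 unfolding directed_set_def by blast
      obtain b where b: "b \<in> B" "\<And>\<beta>. \<beta> \<in> B \<Longrightarrow> (b, \<beta>) \<in> s \<Longrightarrow>
          \<bar>T x - Tnet \<beta> x\<bar> \<le> u \<and> \<bar>T x - Tnet \<beta> x\<bar> \<le> g"
        using eventual_bounds_common[OF dirB u g] by blast
      have "\<bar>S (T x) - Snet \<alpha> (Tnet \<beta> x)\<bar>
          \<le> inverse (real (Suc m)) *\<^sub>R p + real (n * Suc m) *\<^sub>R g + pprt (p - real n *\<^sub>R u) + v"
        if \<alpha>: "\<alpha> \<in> A" "(a, \<alpha>) \<in> r" and \<beta>: "\<beta> \<in> B" "(b, \<beta>) \<in> s" for \<alpha> \<beta>
      proof -
        let ?z = "T x - Tnet \<beta> x"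
        have P: "Snet \<alpha> \<in> Orth"
          using \<alpha>(1) by (rule Orth)
        have "\<bar>Snet \<alpha> ?z\<bar> = \<bar>Snet \<alpha> \<bar>?z\<bar>\<bar>"
          using Orth_abs_abs[OF P, of ?z] by simp
        also have "\<dots> \<le> inverse (real (Suc m)) *\<^sub>R p + real (n * Suc m) *\<^sub>R \<bar>?z\<bar>
            + pprt (p - real n *\<^sub>R u)"
          using b(2)[OF \<beta>] p[OF \<alpha>(1) directed_set_trans[OF dirA a(2) \<alpha>(2)]]
          by (intro Orth_abs_le_uniform[OF P]) auto
        also have "\<dots> \<le> inverse (real (Suc m)) *\<^sub>R p + real (n * Suc m) *\<^sub>R g
            + pprt (p - real n *\<^sub>R u)"
          using b(2)[OF \<beta>] by (intro add_mono scaleR_left_mono order_refl) auto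
        finally have 1: "\<bar>Snet \<alpha> ?z\<bar> \<le> \<dots>" .
        have 2: "\<bar>S (T x) - Snet \<alpha> (T x)\<bar> \<le> v"
          using \<alpha>(1) directed_set_trans[OF dirA a(3) \<alpha>(2)] by (rule va)
        have "S (T x) - Snet \<alpha> (Tnet \<beta> x) = Snet \<alpha> ?z + (S (T x) - Snet \<alpha> (T x))"
          using Orth_linear[OF P] by (simp add: linear_diff)
        then have "\<bar>S (T x) - Snet \<alpha> (Tnet \<beta> x)\<bar> \<le> \<bar>Snet \<alpha> ?z\<bar> + \<bar>S (T x) - Snet \<alpha> (T x)\<bar>"
          by (simp only: abs_triangle_ineq)
        with add_mono[OF 1 2] show ?thesis
          by (rule order_trans[rotated])
      qed
      then show ?thesis
        unfolding eventual_bounds_def prod_rel_def using a(1) b(1)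
        by (intro CollectI bexI[of _ "(a, b)"]) auto
    qed
    \<comment> \<open>eliminate \<open>g\<close>, then \<open>v\<close>, then \<open>n\<close>, and finally \<open>m\<close> by the Archimedean property;
      the order matters, since \<open>g\<close> carries the factor \<open>n (m + 1)\<close>\<close>
    have "h \<le> 0" if h: "\<And>e. e \<in> ?G \<Longrightarrow> h \<le> e" for h
    proof (rule dedekind_complete_archimedean)
      fix m :: nat
      have 1: "h \<le> inverse (real (Suc m)) *\<^sub>R p + pprt (p - real n *\<^sub>R u) + v" if v: "v \<in> ?GS" for n v
      proof (rule le_if_le_add_scaled_eventual_bounds[OF dirB convT])
        fix g assume "g \<in> ?GT"
        from h[OF bound[OF this v, of m n]]
        show "h \<le> inverse (real (Suc m)) *\<^sub>R p + pprt (p - real n *\<^sub>R u) + v + real (n * Suc m) *\<^sub>R g"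
          by (simp only: ac_simps)
      qed simp
      have 2: "h \<le> inverse (real (Suc m)) *\<^sub>R p + pprt (p - real n *\<^sub>R u)" for n
      proof (rule le_if_le_add_scaled_eventual_bounds[OF dirA convS])
        fix v assume "v \<in> ?GS"
        from 1[OF this]
        show "h \<le> inverse (real (Suc m)) *\<^sub>R p + pprt (p - real n *\<^sub>R u) + 1 *\<^sub>R v"
          by simp
      qed simp
      have "h - inverse (real (Suc m)) *\<^sub>R p \<le> 0"
        by (rule p_inf) (use 2 in \<open>simp add: diff_le_eq add.commute\<close>)
      then have "real (Suc m) *\<^sub>R h \<le> real (Suc m) *\<^sub>R inverse (real (Suc m)) *\<^sub>R p"
        by (intro scaleR_left_mono) auto
      then have "real (Suc m) *\<^sub>R h \<le> p"
        by simp
      \<comment> \<open>the bound \<open>p - h\<close> instead of \<open>p\<close> turns \<open>m + 1\<close> into \<open>m\<close>\<close>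
      then show "real m *\<^sub>R h \<le> p - h"
        by (simp add: scaleR_left_distrib le_diff_eq add.commute)
    qed
    with bound[OF u v0] show ?thesis
      unfolding order_convergent_iff_eventual_bounds[OF directed_set_prod_rel[OF dirA dirB]]
      by blast
  qed
  then show "SO_convergent (A \<times> B) (prod_rel r s) (\<lambda>(\<alpha>, \<beta>). Snet \<alpha> \<circ> Tnet \<beta>) (S \<circ> T)"
    using assms(4,6,7) Orth unfolding SO_convergent_def
    by (auto intro!: L_ob_comp simp: Orth_def case_prod_unfold)
qed

end
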